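(* Let $a,b,c\in\mathbb{N}$ with $a\le b\le c$, $3a=b+c$ and $(a,b,c)\neq(4,6,6)$. Then $f(a,b,c)=\left\lfloor \frac{a+b+c}{2}\right\rfloor-1$.
   Context: $\mathbb{N}$ denotes the positive integers and $[n]=\{1,\dots,n\}$. For $a,b,c\in\mathbb{N}$, $f(a,b,c)$ denotes the metric dimension of the Cartesian product $K_a\times K_b\times K_c$ of complete graphs (vertex set $[a]\times[b]\times[c]$, two triples adjacent iff they differ in exactly one coordinate); the metric dimension of a graph is the minimum size of a vertex set $U$ such that every vertex is uniquely determined by its vector of distances to the vertices of $U$. Equivalently, $f(a,b,c)$ is the minimum cardinality of a set $Q\subseteq[a]\times[b]\times[c]$ such that for all distinct $s,s'$ there is $q\in Q$ with $g(s,q)\neq g(s',q)$, where $g(s,q)$ is the number of indices $i\in[3]$ with $s_i=q_i$. *)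

theory Defs
  imports "Graph_Theory.Graph_Theory"
begin

definition complete_graph :: "nat \<Rightarrow> nat pair_pre_digraph" where
  "complete_graph n =
     \<lparr> pverts = {1..n}, parcs = {(u, v). u \<in> {1..n} \<and> v \<in> {1..n} \<and> u \<noteq> v} \<rparr>"

definition cartesian_product ::
    "'a pair_pre_digraph \<Rightarrow> 'b pair_pre_digraph \<Rightarrow> ('a \<times> 'b) pair_pre_digraph" where
  "cartesian_product G H =
     \<lparr> pverts = pverts G \<times> pverts H,
       parcs = {((u, v), (u', v')).
                  u = u' \<and> u \<in> pverts G \<and> (v, v') \<in> parcs H \<or>
                  (u, u') \<in> parcs G \<and> v = v' \<and> v \<in> pverts H} \<rparr>"

text \<open>
  Every arc has cost 1, so the shortest-path cost is the usual graph distance (and infinity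
  between different components). It is meaningful for well-formed graphs only;
  \<open>graph_dist_eq\<close> below spells it out.
\<close>

definition graph_dist :: "'a pair_pre_digraph \<Rightarrow> 'a \<Rightarrow> 'a \<Rightarrow> ereal" where
  "graph_dist G u v = wf_digraph.\<mu> (with_proj G) (\<lambda>_. 1) u v"

definition resolving_set :: "'a pair_pre_digraph \<Rightarrow> 'a set \<Rightarrow> bool" where
  "resolving_set G U \<longleftrightarrow> U \<subseteq> pverts G \<and>
     (\<forall>s \<in> pverts G. \<forall>t \<in> pverts G.
        (\<forall>u \<in> U. graph_dist G s u = graph_dist G t u) \<longrightarrow> s = t)"

text \<open>For a finite graph the minimum exists, since the whole vertex set is resolving.\<close>

definition metric_dimension :: "'a pair_pre_digraph \<Rightarrow> nat" where
  "metric_dimension G = (LEAST k. \<exists>U. finite U \<and> resolving_set G U \<and> card U = k)"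

definition complete_product_dim :: "nat \<Rightarrow> nat \<Rightarrow> nat \<Rightarrow> nat" where
  "complete_product_dim a b c = metric_dimension
     (cartesian_product (complete_graph a)
       (cartesian_product (complete_graph b) (complete_graph c)))"

lemma graph_dist_eq:
  assumes "pair_wf_digraph G"
  shows "graph_dist G u v = (INF p \<in> {p. pre_digraph.awalk (with_proj G) u p v}. ereal (length p))"
proof -
  interpret pair_wf_digraph G by fact
  have "awalk_cost (\<lambda>_. 1) p = real (length p)" for p :: "('a \<times> 'a) list"
    by (induction p) auto
  then show ?thesis
    by (simp add: graph_dist_def \<mu>_def)
qed

lemma complete_digraph_complete_graph:
  "complete_digraph n (with_proj (complete_graph n))"
  by (auto simp: complete_digraph_pair_def complete_graph_def)

lemma pair_graph_complete_graph: "pair_graph (complete_graph n)"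
proof
  show "finite (parcs (complete_graph n))"
    by (rule finite_subset[of _ "{1..n} \<times> {1..n}"]) (auto simp: complete_graph_def)
  show "symmetric (with_proj (complete_graph n))"
    by (auto simp: complete_graph_def symmetric_def intro: symI)
qed (auto simp: complete_graph_def)

lemma pair_graph_cartesian_product:
  assumes "pair_graph G" "pair_graph H"
  shows "pair_graph (cartesian_product G H)"
proof -
  interpret G: pair_graph G by fact
  interpret H: pair_graph H by fact
  have symG: "(u, v) \<in> parcs G \<Longrightarrow> (v, u) \<in> parcs G" for u v
    using G.pair_sym_arcs by (auto simp: symmetric_def dest: symD)
  have symH: "(u, v) \<in> parcs H \<Longrightarrow> (v, u) \<in> parcs H" for u v
    using H.pair_sym_arcs by (auto simp: symmetric_def dest: symD)
  have sub: "parcs (cartesian_product G H) \<subseteq> (pverts G \<times> pverts H) \<times> (pverts G \<times> pverts H)"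
    by (auto simp: cartesian_product_def dest: G.wellformed' H.wellformed')
  show ?thesis
  proof
    show "finite (pverts (cartesian_product G H))"
      by (simp add: cartesian_product_def G.pair_finite_verts H.pair_finite_verts)
    show "finite (parcs (cartesian_product G H))"
      by (rule finite_subset[OF sub])
         (simp add: G.pair_finite_verts H.pair_finite_verts)
    show "symmetric (with_proj (cartesian_product G H))"
      by (auto simp: cartesian_product_def symmetric_def sym_def dest: symG symH)
  next
    fix e assume e: "e \<in> parcs (cartesian_product G H)"
    show "fst e \<in> pverts (cartesian_product G H)" "snd e \<in> pverts (cartesian_product G H)"
      using e by (auto simp: cartesian_product_def dest: G.wellformed' H.wellformed')
    show "fst e \<noteq> snd e"
      using e G.pair_no_loops H.pair_no_loops by (fastforce simp: cartesian_product_def)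
  qed
qed

lemma product_of_three_complete_graphs:
  fixes a b c :: nat
  defines "P \<equiv> cartesian_product (complete_graph a)
                 (cartesian_product (complete_graph b) (complete_graph c))"
  shows "pair_graph P"
    and "pverts P = {1..a} \<times> {1..b} \<times> {1..c}"
    and "((x, y, z), (x', y', z')) \<in> parcs P \<longleftrightarrow>
           (x, y, z) \<in> pverts P \<and> (x', y', z') \<in> pverts P \<and>
           of_bool (x \<noteq> x') + of_bool (y \<noteq> y') + of_bool (z \<noteq> z') = (1::nat)"
  unfolding P_def
    apply (intro pair_graph_cartesian_product pair_graph_complete_graph)
   apply (simp add: cartesian_product_def complete_graph_def)
  apply (cases "x = x'"; cases "y = y'"; cases "z = z'";
      auto simp: cartesian_product_def complete_graph_def)
  done

end

theory Submission
  imports Defs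
begin

text \<open>
  View a landmark set as the edges of a 3-partite hypergraph on the coordinate values; the fibre
  of a value is the set of edges through it.

  Lower bound. In a resolving set each coordinate misses at most one value, and each pair of
  coordinates has at most one pair of values with equal fibres. The latter bounds the number of
  edges with two values of degree 1. Double counting the degrees then gives
  \<open>2 (a + b + c) \<le> 4 q + 6\<close> for \<open>q\<close> landmarks, hence \<open>q \<ge> 2 a - 1\<close> when \<open>b + c = 3 a\<close>.

  Upper bound. Near equality almost all values have degree 1 or 2 and each edge has one value of
  degree 1. For \<open>b = a\<close> a path alternating between the first two coordinates works. Otherwise,
  with \<open>r = b - a - 1\<close> and \<open>p = c - a - 1\<close>, take the disjoint union of a cycle of length
  \<open>2 r + 3\<close> through the first and third coordinates, closed up by one second-coordinate value,
  and a cycle of length \<open>2 p\<close> through the first two coordinates, and leave one value of the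
  second and one of the third coordinate unused. This resolves unless \<open>p = 1\<close>, where the 2-cycle
  has two values with equal fibres; then the roles of \<open>p\<close> and \<open>r\<close> can be exchanged, except for
  \<open>p = r = 1\<close>, that is \<open>(4, 6, 6)\<close>.
\<close>

section \<open>Separation of vertices by a family of landmarks\<close>

text \<open>No landmark separates the two vertices. Landmarks are indexed by \<open>J\<close> with
  one function per coordinate, so that permuting coordinates only permutes \<open>X\<close>,
  \<open>Y\<close>, \<open>Z\<close>.\<close>

definition balanced ::
    "'e set \<Rightarrow> ('e \<Rightarrow> nat) \<Rightarrow> ('e \<Rightarrow> nat) \<Rightarrow> ('e \<Rightarrow> nat) \<Rightarrow>
      nat \<times> nat \<times> nat \<Rightarrow> nat \<times> nat \<times> nat \<Rightarrow> bool" where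
  "balanced J X Y Z = (\<lambda>(x, y, z) (x', y', z'). \<forall>e\<in>J.
     of_bool (X e = x) + of_bool (Y e = y) + of_bool (Z e = z) =
     (of_bool (X e = x') + of_bool (Y e = y') + of_bool (Z e = z') :: nat))"

lemma balancedD:
  assumes "balanced J X Y Z (x, y, z) (x', y', z')" "e \<in> J"
  shows "of_bool (X e = x) + of_bool (Y e = y) + of_bool (Z e = z) =
    (of_bool (X e = x') + of_bool (Y e = y') + of_bool (Z e = z') :: nat)"
  using assms by (simp add: balanced_def)

lemma balanced_sym: "balanced J X Y Z s t \<Longrightarrow> balanced J X Y Z t s"
  by (simp add: balanced_def case_prod_unfold)

lemma balanced_rotate:
  "balanced J X Y Z (x, y, z) (x', y', z') \<longleftrightarrow> balanced J Y Z X (y, z, x) (y', z', x')"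
  by (simp add: balanced_def add_ac)

lemma balanced_swap:
  "balanced J X Y Z (x, y, z) (x', y', z') \<longleftrightarrow> balanced J X Z Y (x, z, y) (x', z', y')"
  by (simp add: balanced_def add_ac)

definition resolves ::
    "'e set \<Rightarrow> ('e \<Rightarrow> nat) \<Rightarrow> ('e \<Rightarrow> nat) \<Rightarrow> ('e \<Rightarrow> nat) \<Rightarrow> nat \<Rightarrow> nat \<Rightarrow> nat \<Rightarrow> bool" where
  "resolves J X Y Z a b c \<longleftrightarrow>
     (\<forall>s \<in> {1..a} \<times> {1..b} \<times> {1..c}. \<forall>t \<in> {1..a} \<times> {1..b} \<times> {1..c}.
        balanced J X Y Z s t \<longrightarrow> s = t)"

lemma resolvesD:
  assumes "resolves J X Y Z a b c" "balanced J X Y Z (x, y, z) (x', y', z')"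
    and "x \<in> {1..a}" "x' \<in> {1..a}" "y \<in> {1..b}" "y' \<in> {1..b}" "z \<in> {1..c}" "z' \<in> {1..c}"
  shows "x = x' \<and> y = y' \<and> z = z'"
  using assms unfolding resolves_def by blast

lemma resolves_rotate: "resolves J X Y Z a b c \<Longrightarrow> resolves J Y Z X b c a"
  unfolding resolves_def using balanced_rotate[of J X Y Z] by fast

lemma resolves_swap: "resolves J X Y Z a b c \<Longrightarrow> resolves J X Z Y a c b"
  unfolding resolves_def using balanced_swap[of J X Y Z] by fast

section \<open>Lower bound by double counting\<close>

definition missing :: "'e set \<Rightarrow> ('e \<Rightarrow> nat) \<Rightarrow> nat \<Rightarrow> nat set" where
  "missing J X n = {1..n} - X ` J"

text \<open>Values of degree 1 are represented by their edges, so that the three coordinates can be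
  compared inside \<open>J\<close>.\<close>

definition leaves :: "'e set \<Rightarrow> ('e \<Rightarrow> nat) \<Rightarrow> 'e set" where
  "leaves J X = {e \<in> J. \<forall>e'\<in>J. X e' = X e \<longrightarrow> e' = e}"

text \<open>Each used value has degree at least 2, or has degree 1 and its edge is counted once more
  as a leaf.\<close>

lemma twice_le_card_leaves_missing:
  assumes "finite J" "X ` J \<subseteq> {1..n}"
  shows "2 * n \<le> card J + card (leaves J X) + 2 * card (missing J X n)"
proof -
  let ?S = "X ` J"
  let ?L = "leaves J X"
  have fin: "finite ?S" "finite ?L" and sub: "X ` ?L \<subseteq> ?S"
    using assms by (auto simp: leaves_def)
  have n: "n = card ?S + card (missing J X n)"
    using card_Diff_subset[OF fin(1) assms(2)] card_mono[OF _ assms(2)]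
    by (simp add: missing_def)
  have J: "card J = (\<Sum>x\<in>?S. card {e \<in> J. X e = x})"
    using sum.group[OF assms(1) fin(1) subset_refl, of "\<lambda>_. 1::nat"] by simp
  have L: "card ?L = (\<Sum>x\<in>?S. card {e \<in> ?L. X e = x})"
    using sum.group[OF fin(2) fin(1) sub, of "\<lambda>_. 1::nat"] by simp
  have "2 \<le> card {e \<in> J. X e = x} + card {e \<in> ?L. X e = x}" if x: "x \<in> ?S" for x
  proof (cases "card {e \<in> J. X e = x} = 1")
    case True
    then obtain e where e: "{e \<in> J. X e = x} = {e}"
      by (auto simp: card_1_singleton_iff)
    have "e \<in> J" "X e = x"
      using e by blast+
    moreover have "e' = e" if "e' \<in> J" "X e' = x" for e'
      using e that by blast
    ultimately have "e \<in> {e \<in> ?L. X e = x}"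
      unfolding leaves_def by blast
    then have "card {e \<in> ?L. X e = x} \<noteq> 0"
      using fin(2) by auto
    with True show ?thesis by simp
  next
    case False
    moreover have "card {e \<in> J. X e = x} \<noteq> 0"
      using x assms(1) by auto
    ultimately show ?thesis by simp
  qed
  then have "(\<Sum>x\<in>?S. 2) \<le> card J + card ?L"
    unfolding J L sum.distrib[symmetric] by (rule sum_mono)
  with n show ?thesis by simp
qed

lemma card_missing_eq:
  assumes "resolves J X Y Z a b c" "1 \<le> b" "1 \<le> c"
  shows "card (missing J X a) = of_bool (missing J X a \<noteq> {})"
proof -
  have "x = x'" if "x \<in> missing J X a" "x' \<in> missing J X a" for x x'
  proof -
    have "x = x' \<and> 1 = (1::nat) \<and> 1 = (1::nat)"
      by (rule resolvesD[OF assms(1)]) (use that assms in \<open>auto simp: missing_def balanced_def\<close>)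
    then show ?thesis by simp
  qed
  then have "card (missing J X a) \<le> 1"
    by (simp add: card_le_Suc0_iff_eq missing_def)
  moreover have "card (missing J X a) = 0 \<longleftrightarrow> missing J X a = {}"
    by (simp only: card_eq_0_iff) (simp add: missing_def)
  ultimately show ?thesis
    by (cases "missing J X a = {}") simp_all
qed

text \<open>
  The vertices \<open>(x, y', 1)\<close> and \<open>(x', y, 1)\<close> are not separated.
\<close>

lemma equal_fibres_unique:
  assumes "resolves J X Y Z a b c" "1 \<le> c"
    and "x \<in> {1..a}" "x' \<in> {1..a}" "y \<in> {1..b}" "y' \<in> {1..b}"
    and "\<And>e. e \<in> J \<Longrightarrow> X e = x \<longleftrightarrow> Y e = y"
    and "\<And>e. e \<in> J \<Longrightarrow> X e = x' \<longleftrightarrow> Y e = y'"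
  shows "x = x'" "y = y'"
proof -
  have "x = x' \<and> y' = y \<and> 1 = (1::nat)"
    by (rule resolvesD[OF assms(1)]) (use assms in \<open>auto simp: balanced_def\<close>)
  then show "x = x'" "y = y'" by auto
qed

lemma common_leaves_bound:
  assumes R: "resolves J X Y Z a b c" and "1 \<le> b" "1 \<le> c" "finite J"
    and ran: "X ` J \<subseteq> {1..a}" "Y ` J \<subseteq> {1..b}"
  shows "card (leaves J X \<inter> leaves J Y) +
    of_bool (missing J X a \<noteq> {} \<and> missing J Y b \<noteq> {}) \<le> 1"
proof -
  let ?I = "leaves J X \<inter> leaves J Y"
  have eq: "X e' = X e \<longleftrightarrow> Y e' = Y e" if "e \<in> ?I" "e' \<in> J" for e e'
    using that unfolding leaves_def by blast
  have rn: "X e \<in> {1..a}" "Y e \<in> {1..b}" if "e \<in> ?I" for e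
    using that ran by (auto simp: leaves_def)
  have fin: "finite ?I"
    using \<open>finite J\<close> by (auto simp: leaves_def)
  have "e = e'" if "e \<in> ?I" "e' \<in> ?I" for e e'
  proof -
    have "X e = X e'"
      by (rule equal_fibres_unique[OF R \<open>1 \<le> c\<close>, of _ _ "Y e" "Y e'"])
         (use that rn eq in blast)+
    with that show ?thesis by (auto simp: leaves_def)
  qed
  then have le: "card ?I \<le> 1"
    using fin by (auto simp: card_le_Suc0_iff_eq)
  show ?thesis
  proof (cases "missing J X a \<noteq> {} \<and> missing J Y b \<noteq> {}")
    case True
    then obtain x y where xy: "x \<in> missing J X a" "y \<in> missing J Y b" by auto
    have "?I = {}"
    proof (rule ccontr)
      assume "?I \<noteq> {}"
      then obtain e where e: "e \<in> ?I" by auto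
      have "x = X e"
        by (rule equal_fibres_unique[OF R \<open>1 \<le> c\<close>, of _ _ y "Y e"])
           (use e xy rn eq in \<open>auto simp: missing_def\<close>)
      with e xy show False by (auto simp: missing_def leaves_def)
    qed
    with True show ?thesis by simp
  next
    case False
    with le show ?thesis by (auto simp: of_bool_def)
  qed
qed

lemma resolves_card_bound:
  assumes R: "resolves J X Y Z a b c" and pos: "1 \<le> a" "1 \<le> b" "1 \<le> c" and fin: "finite J"
    and ran: "X ` J \<subseteq> {1..a}" "Y ` J \<subseteq> {1..b}" "Z ` J \<subseteq> {1..c}"
  shows "a + b + c \<le> 2 * card J + 3"
proof -
  note R' = resolves_rotate[OF R] and R'' = resolves_rotate[OF resolves_rotate[OF R]]
  let ?A = "leaves J X" and ?B = "leaves J Y" and ?C = "leaves J Z"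
  have finL: "finite ?A" "finite ?B" "finite ?C" and sub: "?A \<union> ?B \<union> ?C \<subseteq> J"
    using fin by (auto simp: leaves_def)
  let ?I = "card (?A \<inter> ?B) + card (?B \<inter> ?C) + card (?C \<inter> ?A)"
  let ?M = "card (missing J X a) + card (missing J Y b) + card (missing J Z c)"
  \<comment> \<open>Inclusion-exclusion, with the triple intersection dropped.\<close>
  have "card ?A + card ?B + card ?C \<le> card J + ?I"
  proof -
    have "card ((?A \<union> ?B) \<inter> ?C) \<le> card (?B \<inter> ?C) + card (?C \<inter> ?A)"
      using card_Un_le[of "?B \<inter> ?C" "?C \<inter> ?A"] by (simp add: Int_Un_distrib Int_commute Un_commute)
    moreover have "card (?A \<union> ?B) + card ?C = card (?A \<union> ?B \<union> ?C) + card ((?A \<union> ?B) \<inter> ?C)"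
      using finL by (intro card_Un_Int) auto
    moreover have "card ?A + card ?B = card (?A \<union> ?B) + card (?A \<inter> ?B)"
      using finL by (intro card_Un_Int) auto
    moreover have "card (?A \<union> ?B \<union> ?C) \<le> card J"
      by (rule card_mono[OF fin sub])
    ultimately show ?thesis by linarith
  qed
  moreover have "2 * (a + b + c) \<le> 3 * card J + (card ?A + card ?B + card ?C) + 2 * ?M"
    using add_mono[OF add_mono[OF twice_le_card_leaves_missing[OF fin ran(1)]
        twice_le_card_leaves_missing[OF fin ran(2)]] twice_le_card_leaves_missing[OF fin ran(3)]]
    by (simp add: algebra_simps)
  ultimately have "2 * (a + b + c) \<le> 4 * card J + (2 * ?M + ?I)"
    by simp
  also have "2 * ?M + ?I \<le> 6"
    using common_leaves_bound[OF R pos(2,3) fin ran(1,2)]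
      common_leaves_bound[OF R' pos(3,1) fin ran(2,3)]
      common_leaves_bound[OF R'' pos(1,2) fin ran(3,1)]
    unfolding card_missing_eq[OF R pos(2,3)] card_missing_eq[OF R' pos(3,1)]
      card_missing_eq[OF R'' pos(1,2)]
    by (auto simp: of_bool_def split: if_splits)
  finally have "2 * (a + b + c) \<le> 2 * (2 * card J + 3)"
    by simp
  then show ?thesis
    by (rule mult_left_le_imp_le) simp
qed

section \<open>Graph distance as Hamming distance\<close>

definition differ :: "nat \<times> nat \<times> nat \<Rightarrow> nat \<times> nat \<times> nat \<Rightarrow> nat" where
  "differ = (\<lambda>(x, y, z) (x', y', z'). of_bool (x \<noteq> x') + of_bool (y \<noteq> y') + of_bool (z \<noteq> z'))"

text \<open>An arc changes one coordinate, so a walk has at least \<open>differ u v\<close> arcs;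
  correcting the coordinates one at a time attains this.\<close>

lemma graph_dist_complete_product:
  fixes a b c :: nat
  defines "P \<equiv> cartesian_product (complete_graph a)
                 (cartesian_product (complete_graph b) (complete_graph c))"
  assumes u: "u \<in> pverts P" and v: "v \<in> pverts P"
  shows "graph_dist P u v = ereal (differ u v)"
proof -
  interpret pair_graph P
    unfolding P_def by (rule product_of_three_complete_graphs)
  have verts: "pverts P = {1..a} \<times> {1..b} \<times> {1..c}"
    unfolding P_def by (rule product_of_three_complete_graphs)
  have arcs: "(u, w) \<in> parcs P \<longleftrightarrow> u \<in> pverts P \<and> w \<in> pverts P \<and> differ u w = 1" for u w
    using product_of_three_complete_graphs(3)[of "fst u" "fst (snd u)" "snd (snd u)"
        "fst w" "fst (snd w)" "snd (snd w)" a b c]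
    unfolding P_def[symmetric] differ_def by (simp add: case_prod_unfold)
  have lower: "differ u v \<le> length p" if "awalk u p v" for u p
    using that
  proof (induction p arbitrary: u)
    case Nil
    then show ?case by (auto simp: awalk_Nil_iff differ_def split: prod.splits)
  next
    case (Cons e p)
    then obtain w where w: "e = (u, w)" "(u, w) \<in> parcs P" "awalk w p v"
      by (cases e) (auto simp: awalk_Cons_iff)
    have "differ u v \<le> differ u w + differ w v"
      by (auto simp: differ_def split: prod.splits)
    with Cons.IH[OF w(3)] w(2) show ?case by (simp add: arcs)
  qed
  have upper: "\<exists>p. awalk u p v \<and> length p = differ u v" if "u \<in> pverts P" for u
    using that
  proof (induction "differ u v" arbitrary: u)
    case 0
    then have "u = v"
      by (auto simp: differ_def split: prod.splits)
    with 0 show ?case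
      by (intro exI[of _ "[]"]) (auto simp: awalk_Nil_iff)
  next
    case (Suc k)
    obtain x y z x' y' z' where uv: "u = (x, y, z)" "v = (x', y', z')"
      by (cases u, cases v) auto
    define w where "w = (if x \<noteq> x' then (x', y, z) else if y \<noteq> y' then (x, y', z) else (x, y, z'))"
    have w: "w \<in> pverts P" "differ u w = 1" "k = differ w v"
      using Suc.hyps(2) Suc.prems v uv by (auto simp: w_def differ_def verts split: if_splits)
    then obtain p where p: "awalk w p v" "length p = differ w v"
      using Suc.hyps(1) by blast
    have "awalk u ((u, w) # p) v"
      using p w Suc.prems by (simp add: awalk_Cons_iff arcs)
    with p w Suc.hyps(2) show ?case
      by (intro exI[of _ "(u, w) # p"]) simp
  qed
  have "(INF p \<in> {p. awalk u p v}. ereal (length p)) = ereal (differ u v)"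
  proof (rule antisym)
    from upper[OF u] show "(INF p \<in> {p. awalk u p v}. ereal (length p)) \<le> ereal (differ u v)"
      by (auto intro: INF_lower2)
    show "ereal (differ u v) \<le> (INF p \<in> {p. awalk u p v}. ereal (length p))"
      using lower by (intro INF_greatest) auto
  qed
  then show ?thesis
    by (subst graph_dist_eq) (unfold_locales, simp)
qed

text \<open>Agreements and disagreements of two triples add up to 3, so equal distances mean equally
  many agreements.\<close>

lemma resolving_set_iff_resolves:
  fixes a b c :: nat
  defines "P \<equiv> cartesian_product (complete_graph a)
                 (cartesian_product (complete_graph b) (complete_graph c))"
  assumes "(\<lambda>e. (X e, Y e, Z e)) ` J \<subseteq> {1..a} \<times> {1..b} \<times> {1..c}"
  shows "resolving_set P ((\<lambda>e. (X e, Y e, Z e)) ` J) \<longleftrightarrow> resolves J X Y Z a b c"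
proof -
  have verts: "pverts P = {1..a} \<times> {1..b} \<times> {1..c}"
    unfolding P_def by (rule product_of_three_complete_graphs)
  have "(\<forall>u\<in>(\<lambda>e. (X e, Y e, Z e)) ` J. graph_dist P s u = graph_dist P t u) \<longleftrightarrow>
      balanced J X Y Z s t" if "s \<in> pverts P" "t \<in> pverts P" for s t
  proof -
    have "differ s (X e, Y e, Z e) + (of_bool (X e = fst s) + of_bool (Y e = fst (snd s)) +
        of_bool (Z e = snd (snd s))) = 3" for s e
      by (auto simp: differ_def case_prod_unfold)
    note sum3 = this[of s] this[of t]
    have "graph_dist P s (X e, Y e, Z e) = graph_dist P t (X e, Y e, Z e) \<longleftrightarrow>
      of_bool (X e = fst s) + of_bool (Y e = fst (snd s)) + of_bool (Z e = snd (snd s)) =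
      (of_bool (X e = fst t) + of_bool (Y e = fst (snd t)) + of_bool (Z e = snd (snd t)) :: nat)"
      if "e \<in> J" for e
    proof -
      have "(X e, Y e, Z e) \<in> pverts P"
        using that assms(2) verts by auto
      then have d: "graph_dist P w (X e, Y e, Z e) = ereal (differ w (X e, Y e, Z e))"
        if "w \<in> pverts P" for w
        using that unfolding P_def by (intro graph_dist_complete_product)
      have "graph_dist P s (X e, Y e, Z e) = graph_dist P t (X e, Y e, Z e) \<longleftrightarrow>
          differ s (X e, Y e, Z e) = differ t (X e, Y e, Z e)"
        unfolding d[OF \<open>s \<in> pverts P\<close>] d[OF \<open>t \<in> pverts P\<close>] by simp
      then show ?thesis
        using sum3[of e] by (intro iffI; linarith)
    qed
    then show ?thesis
      by (simp add: balanced_def case_prod_unfold)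
  qed
  then show ?thesis
    using assms(2) unfolding resolving_set_def resolves_def verts by simp
qed

lemma complete_product_dim_le:
  fixes X Y Z :: "nat \<Rightarrow> nat"
  assumes "resolves {..<n} X Y Z a b c"
    and "\<And>e. e < n \<Longrightarrow> X e \<in> {1..a} \<and> Y e \<in> {1..b} \<and> Z e \<in> {1..c}"
  shows "complete_product_dim a b c \<le> n"
proof -
  let ?U = "(\<lambda>e. (X e, Y e, Z e)) ` {..<n}"
  have "resolving_set (cartesian_product (complete_graph a)
      (cartesian_product (complete_graph b) (complete_graph c))) ?U"
    by (subst resolving_set_iff_resolves) (use assms in auto)
  then have "complete_product_dim a b c \<le> card ?U"
    unfolding complete_product_dim_def metric_dimension_def by (intro Least_le) auto
  also have "\<dots> \<le> n"
    using card_image_le[of "{..<n}"] by simp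
  finally show ?thesis .
qed

lemma complete_product_dim_ge:
  assumes pos: "1 \<le> a" "1 \<le> b" "1 \<le> c"
  shows "a + b + c \<le> 2 * complete_product_dim a b c + 3"
proof -
  define P where "P = cartesian_product (complete_graph a)
                 (cartesian_product (complete_graph b) (complete_graph c))"
  interpret pair_graph P
    unfolding P_def by (rule product_of_three_complete_graphs)
  have verts: "pverts P = {1..a} \<times> {1..b} \<times> {1..c}"
    unfolding P_def by (rule product_of_three_complete_graphs)
  have dist: "graph_dist P u v = ereal (differ u v)" if "u \<in> pverts P" "v \<in> pverts P" for u v
    using graph_dist_complete_product that unfolding P_def by blast
  \<comment> \<open>The whole vertex set resolves, since \<open>s\<close> itself separates
    \<open>s\<close> from \<open>t\<close>; hence the minimum is attained.\<close>
  have "s = t" if "s \<in> pverts P" "t \<in> pverts P"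
    and "\<forall>u\<in>pverts P. graph_dist P s u = graph_dist P t u" for s t
  proof -
    have "differ s s = differ t s"
      using that(3)[rule_format, OF that(1)] that by (simp add: dist)
    then show ?thesis
      by (auto simp: differ_def split: prod.splits if_splits)
  qed
  then have "resolving_set P (pverts P)"
    unfolding resolving_set_def by blast
  moreover have "complete_product_dim a b c =
      (LEAST k. \<exists>U. finite U \<and> resolving_set P U \<and> card U = k)"
    by (simp add: complete_product_dim_def metric_dimension_def P_def)
  ultimately have "\<exists>U. finite U \<and> resolving_set P U \<and> card U = complete_product_dim a b c"
    by (simp only:) (rule LeastI_ex, use pair_finite_verts in blast)
  then obtain U where U: "finite U" "resolving_set P U" "card U = complete_product_dim a b c"
    by blast
  have sub: "U \<subseteq> {1..a} \<times> {1..b} \<times> {1..c}"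
    using U(2) unfolding resolving_set_def verts by (rule conjunct1)
  have "(\<lambda>u. (fst u, fst (snd u), snd (snd u))) ` U = U"
    by simp
  with U(2) sub have "resolves U fst (\<lambda>u. fst (snd u)) (\<lambda>u. snd (snd u)) a b c"
    unfolding P_def by (subst resolving_set_iff_resolves[symmetric]) simp_all
  then have "a + b + c \<le> 2 * card U + 3"
  proof (rule resolves_card_bound)
    show "fst ` U \<subseteq> {1..a}" "(\<lambda>u. fst (snd u)) ` U \<subseteq> {1..b}" "(\<lambda>u. snd (snd u)) ` U \<subseteq> {1..c}"
      using sub by fastforce+
  qed (use pos U in simp_all)
  then show ?thesis unfolding U(3) .
qed

section \<open>Criteria for a family to resolve\<close>

text \<open>The fibre of \<open>x\<close> is nonempty and is no fibre of \<open>Y\<close>. A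
  balanced pair that differs at \<open>x\<close> must then differ in the third coordinate
  too.\<close>

definition unmatched :: "'e set \<Rightarrow> ('e \<Rightarrow> nat) \<Rightarrow> ('e \<Rightarrow> nat) \<Rightarrow> nat \<Rightarrow> bool" where
  "unmatched J X Y x \<longleftrightarrow>
     (\<exists>e\<in>J. X e = x) \<and> (\<forall>y. \<exists>e\<in>J. \<not> (X e = x \<longleftrightarrow> Y e = y))"

lemma unmatched_if_fibre_split:
  assumes "e \<in> J" "X e = x" "f \<in> J" "X f = x" "Y e \<noteq> Y f"
  shows "unmatched J X Y x"
  using assms unfolding unmatched_def by metis

lemma unmatched_if_fibre_meets:
  assumes "e \<in> J" "X e = x" "f \<in> J" "X f \<noteq> x" "Y e = Y f"
  shows "unmatched J X Y x"
  using assms unfolding unmatched_def by metis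

text \<open>If \<open>y = y'\<close>, the middle terms cancel. An edge through \<open>x\<close> then
  passes through \<open>z'\<close> and not \<open>z\<close>, and the balance identifies the fibre of
  \<open>x\<close> with that of \<open>z'\<close>.\<close>

lemma balanced_middle_distinct:
  assumes H: "balanced J X Y Z (x, y, z) (x', y', z')" and "unmatched J X Z x" "x \<noteq> x'"
  shows "y \<noteq> y'"
proof
  assume "y = y'"
  with H have eq: "of_bool (X e = x) + of_bool (Z e = z) =
      (of_bool (X e = x') + of_bool (Z e = z') :: nat)" if "e \<in> J" for e
    using that by (auto simp: balanced_def)
  obtain e where "e \<in> J" "X e = x"
    using assms(2) by (auto simp: unmatched_def)
  with eq[of e] \<open>x \<noteq> x'\<close> have "z \<noteq> z'" by auto
  have "X e = x \<longleftrightarrow> Z e = z'" if "e \<in> J" for e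
    using eq[OF that] \<open>x \<noteq> x'\<close> \<open>z \<noteq> z'\<close> by (auto simp: of_bool_def split: if_splits)
  with assms(2) show False
    by (auto simp: unmatched_def)
qed

lemma balanced_last_distinct:
  assumes "balanced J X Y Z (x, y, z) (x', y', z')" "unmatched J X Y x" "x \<noteq> x'"
  shows "z \<noteq> z'"
  using balanced_middle_distinct[OF assms(1)[THEN balanced_swap[THEN iffD1]] assms(2,3)] .

lemma balanced_first_distinct:
  assumes "balanced J X Y Z (x, y, z) (x', y', z')" "unmatched J Y Z y" "y \<noteq> y'"
  shows "x \<noteq> x'"
  using balanced_last_distinct[OF assms(1)[THEN balanced_rotate[THEN iffD1]] assms(2,3)] .

lemma resolvesI:
  assumes X: "\<And>x y z x' y' z'. balanced J X Y Z (x, y, z) (x', y', z') \<Longrightarrow>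
      x \<in> {1..a} \<Longrightarrow> x' \<in> {1..a} \<Longrightarrow> y \<in> {1..b} \<Longrightarrow> y' \<in> {1..b} \<Longrightarrow> x = x'"
    and Y: "\<And>y y'. y \<in> {1..b} \<Longrightarrow> y' \<in> {1..b} \<Longrightarrow> y \<noteq> y' \<Longrightarrow>
      unmatched J Y Z y \<or> unmatched J Y Z y'"
    and Z: "\<And>z z'. z \<in> {1..c} \<Longrightarrow> z' \<in> {1..c} \<Longrightarrow> z \<noteq> z' \<Longrightarrow> z \<in> Z ` J \<or> z' \<in> Z ` J"
  shows "resolves J X Y Z a b c"
  unfolding resolves_def
proof (intro ballI impI)
  fix s t
  assume st: "s \<in> {1..a} \<times> {1..b} \<times> {1..c}" "t \<in> {1..a} \<times> {1..b} \<times> {1..c}" "balanced J X Y Z s t"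
  obtain x y z x' y' z' where eq: "s = (x, y, z)" "t = (x', y', z')"
    by (cases s, cases t)
  with st have H: "balanced J X Y Z (x, y, z) (x', y', z')"
    and r: "x \<in> {1..a}" "x' \<in> {1..a}" "y \<in> {1..b}" "y' \<in> {1..b}" "z \<in> {1..c}" "z' \<in> {1..c}"
    by simp_all
  have x: "x = x'"
    using X[OF H] r by simp
  then have y: "y = y'"
    using Y[OF r(3,4)] balanced_first_distinct[OF H] balanced_first_distinct[OF balanced_sym[OF H]]
    by auto
  have "z = z'"
  proof (rule ccontr)
    assume "z \<noteq> z'"
    then obtain e where "e \<in> J" "Z e = z \<or> Z e = z'"
      using Z[OF r(5,6)] by auto
    with \<open>z \<noteq> z'\<close> balancedD[OF H, of e] show False
      by (auto simp: x y)
  qed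
  with x y eq show "s = t" by simp
qed

text \<open>
  At \<open>g\<close> the balance forces \<open>Z g = z\<close>. The fibres of \<open>x\<close>, \<open>z\<close> and of \<open>y'\<close>, \<open>z'\<close> then both
  cover \<open>{e, f, g}\<close> once and cancel, so \<open>x'\<close> and \<open>y\<close> have the same fibre.
\<close>

lemma balanced_exchange:
  assumes H: "balanced J X Y Z (x, y, z) (x', y', z')"
    and neq: "x \<noteq> x'" "y \<noteq> y'" "z \<noteq> z'"
    and X: "\<And>h. h \<in> J \<Longrightarrow> X h = x \<longleftrightarrow> h = e \<or> h = f"
    and Y: "\<And>h. h \<in> J \<Longrightarrow> Y h = y' \<longleftrightarrow> h = e \<or> h = g"
    and Z: "\<And>h. h \<in> J \<Longrightarrow> Z h = z' \<longleftrightarrow> h = f" "\<And>h. h \<in> J \<Longrightarrow> Z h = Z g \<longleftrightarrow> h = g"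
    and "g \<in> J" "g \<noteq> e" "g \<noteq> f" "e \<noteq> f"
  shows "\<not> unmatched J X Y x'"
proof -
  have "Z g = z" 
    using balancedD[OF H \<open>g \<in> J\<close>] X[of g] Y[of g] Z(1)[of g] assms(9-) neq
    by (auto simp: of_bool_def split: if_splits)
  then have Zz: "Z h = z \<longleftrightarrow> h = g" if "h \<in> J" for h
    using Z(2)[OF that] by simp
  have "X h = x' \<longleftrightarrow> Y h = y" if "h \<in> J" for h
    using balancedD[OF H that] X[OF that] Y[OF that] Z(1)[OF that] Zz[OF that] assms(10-)
    by (auto simp: of_bool_def split: if_splits)
  then show ?thesis
    by (auto simp: unmatched_def)
qed

section \<open>Constructions for the upper bound\<close>

text \<open>Consecutive edges share a value of \<open>Y\<close> and of \<open>X\<close> in turn,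
  while \<open>Z\<close> is injective and omits 1. The ends of the path are the values 1 of
  \<open>X\<close> and \<open>a\<close> of \<open>Y\<close>.\<close>

lemma path_resolves:
  fixes a :: nat
  defines "X \<equiv> \<lambda>e. (e + 1) div 2 + 1" and "Y \<equiv> \<lambda>e. e div 2 + 1" and "Z \<equiv> \<lambda>e. e + 2"
  assumes "1 \<le> a"
  shows "resolves {..<2 * a - 1} X Y Z a a (2 * a)"
    and "\<And>e. e < 2 * a - 1 \<Longrightarrow> X e \<in> {1..a} \<and> Y e \<in> {1..a} \<and> Z e \<in> {1..2 * a}"
proof -
  let ?J = "{..<2 * a - 1}"
  have X: "X h = x \<longleftrightarrow> h + 3 = 2 * x \<or> h + 2 = 2 * x" for h x
    unfolding X_def by presburger
  have Y: "Y h = y \<longleftrightarrow> h + 2 = 2 * y \<or> h + 1 = 2 * y" for h y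
    unfolding Y_def by presburger
  have XY: "unmatched ?J X Y x" if "x \<in> {1..a}" "2 \<le> a" for x
  proof (cases "x = 1")
    case True
    with that show ?thesis
      by (intro unmatched_if_fibre_meets[of 0 _ _ _ 1]) (auto simp: X_def Y_def)
  next
    case False
    define k where "k = x - 2"
    have "x = k + 2"
      using that False unfolding k_def atLeastAtMost_iff by linarith
    with that show ?thesis
      by (intro unmatched_if_fibre_split[of "2 * k + 1" _ _ _ "2 * k + 2"]) (auto simp: X_def Y_def)
  qed
  have XZ: "unmatched ?J X Z (k + 2)" if "k + 2 \<le> a" for k
    using that by (intro unmatched_if_fibre_split[of "2 * k + 1" _ _ _ "2 * k + 2"]) (auto simp: X_def Z_def)
  have YZ: "unmatched ?J Y Z y" if "1 \<le> y" "y < a" for y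
    using that by (intro unmatched_if_fibre_split[of "2 * y - 2" _ _ _ "2 * y - 1"]) (auto simp: Y_def Z_def)
  have neq_1: False
    if H: "balanced ?J X Y Z (x, y, z) (x', y', z')" and r: "x \<in> {1..a}" "x' \<in> {1..a}" "y \<in> {1..a}"
      and x: "x \<noteq> x'" "x \<noteq> 1" for x y z x' y' z'
  proof -
    define k where "k = x - 2"
    have k: "x = k + 2"
      using r(1) x(2) unfolding k_def atLeastAtMost_iff by linarith
    define e where "e = 2 * k + 1"
    define f where "f = 2 * k + 2"
    have ef: "e \<in> ?J" "f \<in> ?J" "X e = x" "X f = x"
      using r by (auto simp: e_def f_def k X_def)
    have y: "y \<noteq> y'"
      using balanced_middle_distinct[OF H] XZ[of k] r x k by simp
    have z: "z \<noteq> z'"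
      using balanced_last_distinct[OF H] XY[of x] r x by simp
    have "X e \<noteq> x'" "X f \<noteq> x'"
      using ef x by auto
    moreover have "Y e = k + 1" "Y f = k + 2" "Z e = 2 * k + 3" "Z f = 2 * k + 4"
      by (simp_all add: Y_def Z_def e_def f_def)
    \<comment> \<open>\<open>x'\<close> misses both edges, and \<open>Y\<close> and \<open>Z\<close>
      each distinguish them, so \<open>y'\<close> covers one edge and \<open>z'\<close> the
      other.\<close>
    ultimately consider "y' = k + 1" "z' = 2 * k + 4" | "z' = 2 * k + 3" "y' = k + 2"
      using balancedD[OF H ef(1)] balancedD[OF H ef(2)] ef
      by (auto simp: of_bool_def split: if_splits)
    then show False
    proof cases
      case 1
      \<comment> \<open>The witness \<open>2 * k\<close> is the other edge through
        \<open>y'\<close>, the neighbour of \<open>e\<close> on the path.\<close>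
      have "\<not> unmatched ?J X Y x'"
        by (rule balanced_exchange[OF H x(1) y z, of e f "2 * k"])
          (use 1 ef in \<open>auto simp: X Y Z_def k e_def f_def\<close>)
      then show False
        using XY[of x'] r x by simp
    next
      case 2
      show False
      proof (cases "k + 2 = a")
        case False
        have "\<not> unmatched ?J X Y x'"
          by (rule balanced_exchange[OF H x(1) y z, of f e "2 * k + 3"])
            (use 2 ef False r in \<open>auto simp: X Y Z_def k e_def f_def\<close>)
        then show False
          using XY[of x'] r x by simp
      next
        case True
        \<comment> \<open>Now \<open>f\<close> is the last edge and has no further neighbour. The
          fibre of \<open>x\<close> cancels against those of \<open>y'\<close> and
          \<open>z'\<close>, which puts the fibre of \<open>y\<close> inside that of
          \<open>x'\<close>; but \<open>X\<close> distinguishes the two edges through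
          \<open>y\<close>.\<close>
        have "Y h = y \<Longrightarrow> X h = x'" if "h \<in> ?J" for h
          using balancedD[OF H that] 2 that True
          by (auto simp: X Y Z_def k e_def f_def of_bool_def split: if_splits)
        moreover obtain m where m: "y = m + 1"
          using r by (cases y) auto
        ultimately have "X (2 * m) = x'" "X (2 * m + 1) = x'"
          using r y 2 True by (simp_all add: Y_def)
        then show False
          by (simp add: X_def)
      qed
    qed
  qed
  show "\<And>e. e < 2 * a - 1 \<Longrightarrow> X e \<in> {1..a} \<and> Y e \<in> {1..a} \<and> Z e \<in> {1..2 * a}"
    by (auto simp: X_def Y_def Z_def)
  show "resolves ?J X Y Z a a (2 * a)"
  proof (rule resolvesI)
    fix x y z x' y' z'
    assume H: "balanced ?J X Y Z (x, y, z) (x', y', z')"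
      and "x \<in> {1..a}" "x' \<in> {1..a}" "y \<in> {1..a}" "y' \<in> {1..a}"
    then show "x = x'"
      using neq_1[OF H] neq_1[OF balanced_sym[OF H]] by (cases "x = 1") auto
  next
    fix y y' assume r: "y \<in> {1..a}" "y' \<in> {1..a}" "y \<noteq> y'"
    then have "y < a \<or> y' < a"
      unfolding atLeastAtMost_iff by linarith
    then show "unmatched ?J Y Z y \<or> unmatched ?J Y Z y'"
      using YZ r by auto
  next
    fix z z' assume r: "z \<in> {1..2 * a}" "z' \<in> {1..2 * a}" "z \<noteq> z'"
    have "z \<in> Z ` ?J" if "z \<in> {2..2 * a}" for z
      by (rule image_eqI[of _ _ "z - 2"]) (use that in \<open>auto simp: Z_def\<close>)
    moreover have "2 \<le> z \<or> 2 \<le> z'"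
      using r unfolding atLeastAtMost_iff by linarith
    ultimately show "z \<in> Z ` ?J \<or> z' \<in> Z ` ?J"
      using r by auto
  qed
qed

text \<open>
  Edges \<open>0, \<dots>, 2 r + 2\<close> form the odd cycle; in it the first coordinate pairs \<open>2 i - 1\<close> with
  \<open>2 i\<close>, the third pairs \<open>2 i\<close> with \<open>2 i + 1\<close> and \<open>0\<close> with \<open>2 r + 2\<close>, and the second
  pairs \<open>0\<close> with \<open>1\<close>. The remaining \<open>2 p\<close> edges form the even cycle, which the second
  coordinate closes by pairing \<open>2 r + 3\<close> with \<open>2 r + 2 p + 2\<close>. The value 1 is unused in the
  second and third coordinates.
\<close>

lemma triangle_cycle_resolves:
  fixes r p :: nat
  defines "X \<equiv> \<lambda>e. (e + 1) div 2 + 1"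
    and "Y \<equiv> \<lambda>e. if e \<le> 1 then 2 else if e \<le> 2 * r + 2 then e + 1
              else if e = 2 * r + 2 * p + 2 then 2 * r + 4 else r + 3 + e div 2"
    and "Z \<equiv> \<lambda>e. if e = 0 \<or> e = 2 * r + 2 then 2 else if e = 1 then r + 3
              else if e \<le> 2 * r + 1 then e div 2 + 2 else e + 1 - r"
  assumes p: "p \<noteq> 1"
  shows "resolves {..<2 * r + 2 * p + 3} X Y Z (p + r + 2) (p + 2 * r + 3) (2 * p + r + 3)"
    and "\<And>e. e < 2 * r + 2 * p + 3 \<Longrightarrow>
      X e \<in> {1..p + r + 2} \<and> Y e \<in> {1..p + 2 * r + 3} \<and> Z e \<in> {1..2 * p + r + 3}"
proof -
  let ?n = "2 * r + 2 * p + 3"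
  let ?J = "{..<?n}" and ?a = "p + r + 2" and ?b = "p + 2 * r + 3" and ?c = "2 * p + r + 3"
  have X: "X h = x \<longleftrightarrow> h + 3 = 2 * x \<or> h + 2 = 2 * x" for h x
    unfolding X_def by presburger
  have Y_small: "Y 0 = 2" "Y 1 = 2" "Y (2 * r + 2) = 2 * r + 3"
    and Z_small: "Z 0 = 2" "Z 1 = r + 3" "Z (2 * r + 2) = 2"
    by (auto simp: Y_def Z_def)
  have Y_even: "Y (2 * m) = (if m \<le> r + 1 then 2 * m + 1 else if m = r + p + 1 then 2 * r + 4 else r + 3 + m)"
    and Y_odd: "Y (2 * m + 1) = (if m \<le> r then 2 * m + 2 else r + 3 + m)"
    and Z_odd: "Z (2 * m + 1) = (if m \<le> r then m + 2 else 2 * m + 2 - r)"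
    if "1 \<le> m" for m
    using that by (auto simp: Y_def Z_def) presburger+
  have Z_even: "Z (2 * m) = (if m = r + 1 then 2 else if m \<le> r then m + 2 else 2 * m + 1 - r)"
    if "1 \<le> m" for m
    using that by (auto simp: Z_def)
  \<comment> \<open>This needs \<open>p \<noteq> 1\<close>: for \<open>p = 1\<close> the edges
    \<open>2 * r + 3\<close> and \<open>2 * r + 4\<close> share the value \<open>2 * r + 4\<close>
    of \<open>Y\<close>.\<close>
  have neq: "Y (2 * m + 1) \<noteq> Y (2 * (m + 1))" "Z (2 * m + 1) \<noteq> Z (2 * (m + 1))"
    if "1 \<le> m" "m \<le> p + r" for m
    using Y_odd[of m] Y_even[of "m + 1"] Z_odd[of m] Z_even[of "m + 1"] that p
    by (auto split: if_splits)
  have XY: "unmatched ?J X Y x" and XZ: "unmatched ?J X Z x" if "x \<in> {1..?a}" for x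
  proof -
    have "x = 1 \<or> x = 2 \<or> (\<exists>k. x = k + 3 \<and> k + 1 \<le> p + r)"
      using that unfolding atLeastAtMost_iff by presburger
    then consider "x = 1" | "x = 2" | k where "x = k + 3" "k + 1 \<le> p + r"
      by blast
    then have "unmatched ?J X Y x \<and> unmatched ?J X Z x"
    proof cases
      case 1
      have "unmatched ?J X Y x"
        by (rule unmatched_if_fibre_meets[of 0 _ _ _ 1]) (use 1 Y_small in \<open>auto simp: X\<close>)
      moreover have "unmatched ?J X Z x"
        by (rule unmatched_if_fibre_meets[of 0 _ _ _ "2 * r + 2"]) (use 1 Z_small in \<open>auto simp: X\<close>)
      ultimately show ?thesis ..
    next
      case 2
      have "unmatched ?J X Y x"
        by (rule unmatched_if_fibre_split[of 1 _ _ _ 2]) (use 2 in \<open>auto simp: X Y_def\<close>)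
      moreover have "unmatched ?J X Z x"
        by (rule unmatched_if_fibre_split[of 1 _ _ _ 2]) (use 2 in \<open>auto simp: X Z_def\<close>)
      ultimately show ?thesis ..
    next
      case (3 k)
      have "unmatched ?J X Y x"
        by (rule unmatched_if_fibre_split[of "2 * (k + 1) + 1" _ _ _ "2 * (k + 1 + 1)"])
          (use 3 neq[of "k + 1"] in \<open>auto simp: X\<close>)
      moreover have "unmatched ?J X Z x"
        by (rule unmatched_if_fibre_split[of "2 * (k + 1) + 1" _ _ _ "2 * (k + 1 + 1)"])
          (use 3 neq[of "k + 1"] in \<open>auto simp: X\<close>)
      ultimately show ?thesis ..
    qed
    then show "unmatched ?J X Y x" "unmatched ?J X Z x" by auto
  qed
  have YZ: "unmatched ?J Y Z y" if "y \<in> {2..?b}" for y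
  proof -
    \<comment> \<open>In order: the value shared by edges 0 and 1, that of edge
      \<open>2 * r + 2\<close>, those of the even and the odd edges in between, and those on the
      even cycle.\<close>
    have "y = 2 \<or> y = 2 * r + 3 \<or> (\<exists>m. y = 2 * m + 1 \<and> 1 \<le> m \<and> m \<le> r) \<or>
      (\<exists>m. y = 2 * m + 2 \<and> 1 \<le> m \<and> m \<le> r) \<or> (\<exists>d. y = r + 3 + d \<and> r < d \<and> d \<le> r + p)"
      using that unfolding atLeastAtMost_iff by presburger
    then consider "y = 2" | "y = 2 * r + 3" | m where "y = 2 * m + 1" "1 \<le> m" "m \<le> r"
      | m where "y = 2 * m + 2" "1 \<le> m" "m \<le> r" | d where "y = r + 3 + d" "r < d" "d \<le> r + p"
      by blast
    then show ?thesis
    proof cases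
      case 1
      show ?thesis
        by (rule unmatched_if_fibre_split[of 0 _ _ _ 1]) (use 1 Y_small Z_small in auto)
    next
      case 2
      show ?thesis
        by (rule unmatched_if_fibre_meets[of "2 * r + 2" _ _ _ 0]) (use 2 Y_small Z_small in auto)
    next
      case (3 m)
      show ?thesis
        by (rule unmatched_if_fibre_meets[of "2 * m" _ _ _ "2 * m + 1"])
          (use 3 Y_even[of m] Y_odd[of m] Z_even[of m] Z_odd[of m] in auto)
    next
      case (4 m)
      show ?thesis
        by (rule unmatched_if_fibre_meets[of "2 * m + 1" _ _ _ "2 * m"])
          (use 4 Y_even[of m] Y_odd[of m] Z_even[of m] Z_odd[of m] in auto)
    next
      case (5 d)
      show ?thesis
      proof (cases "d = r + 1")
        \<comment> \<open>Edge \<open>2 * d\<close> still belongs to the odd cycle, so the partner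
          of \<open>2 * d + 1\<close> is the last edge.\<close>
        case True
        show ?thesis
          by (rule unmatched_if_fibre_split[of "2 * d + 1" _ _ _ "2 * (r + p + 1)"])
            (use 5 True Y_even[of "r + p + 1"] Y_odd[of d] Z_even[of "r + p + 1"] Z_odd[of d] in auto)
      next
        case False
        show ?thesis
          by (rule unmatched_if_fibre_split[of "2 * d + 1" _ _ _ "2 * d"])
            (use 5 False Y_even[of d] Y_odd[of d] Z_even[of d] Z_odd[of d] in auto)
      qed
    qed
  qed
  have Z_surj: "z \<in> Z ` ?J" if "z \<in> {2..?c}" for z
  proof -
    consider "z = 2" | "z = r + 3" | "3 \<le> z" "z \<le> r + 2" | "r + 4 \<le> z"
      using \<open>z \<in> _\<close> unfolding atLeastAtMost_iff by linarith
    then show ?thesis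
    proof cases
      case 1
      then show ?thesis using Z_small by (intro image_eqI[of _ _ 0]) auto
    next
      case 2
      then show ?thesis using Z_small by (intro image_eqI[of _ _ 1]) auto
    next
      case 3
      then show ?thesis by (intro image_eqI[of _ _ "2 * (z - 2)"]) (use Z_even[of "z - 2"] in auto)
    next
      case 4
      then show ?thesis using that by (intro image_eqI[of _ _ "z + r - 1"]) (auto simp: Z_def)
    qed
  qed
  \<comment> \<open>The fibre \<open>{e, f}\<close> of \<open>x\<close> lies on the even cycle if
    \<open>r \<le> k\<close>, where values of \<open>Z\<close> have degree 1. Otherwise it lies on
    the odd cycle, where those of \<open>Y\<close> do from edge 2 on, and \<open>Y\<close> and
    \<open>Z\<close> exchange roles.\<close>
  have ge_3: False
    if H: "balanced ?J X Y Z (x, y, z) (x', y', z')"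
      and r: "x \<in> {1..?a}" "x' \<in> {1..?a}" and x: "x \<noteq> x'" "3 \<le> x" for x y z x' y' z'
  proof -
    have y: "y \<noteq> y'" and z: "z \<noteq> z'"
      using balanced_middle_distinct[OF H XZ x(1)] balanced_last_distinct[OF H XY x(1)] r by auto
    define k where "k = x - 3"
    have k: "x = k + 3" "k + 1 \<le> p + r"
      using r(1) x(2) unfolding k_def atLeastAtMost_iff by linarith+
    define e where "e = 2 * (k + 1) + 1"
    define f where "f = 2 * (k + 2)"
    have ef: "e \<in> ?J" "f \<in> ?J" "X e = x" "X f = x"
      using k by (auto simp: e_def f_def X)
    then have "X e \<noteq> x'" "X f \<noteq> x'"
      using x by auto
    moreover have "Y e \<noteq> Y f" "Z e \<noteq> Z f"
      using neq[of "k + 1"] k by (auto simp: e_def f_def)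
    ultimately consider "Y e = y'" "Z f = z'" | "Z e = z'" "Y f = y'"
      using balancedD[OF H ef(1)] balancedD[OF H ef(2)] ef
      by (auto simp: of_bool_def split: if_splits)
    note cases = this
    note H' = H[THEN balanced_swap[THEN iffD1]]
    have XYx': "unmatched ?J X Y x'" and XZx': "unmatched ?J X Z x'"
      using XY XZ r by auto
    show False
    proof (cases "r \<le> k")
      case True
      have Zinj: "Z h = Z g \<longleftrightarrow> h = g" if "2 * r + 3 \<le> g" "h \<in> ?J" for h g
        using that by (auto simp: Z_def)
      from cases show False
      proof cases
        case 1
        \<comment> \<open>The neighbour of \<open>e\<close> through \<open>Y\<close>; for
          \<open>k = r\<close>, \<open>e\<close> is the first edge of the even cycle and its
          neighbour is the last.\<close>
        define g where "g = (if k = r then 2 * (r + p + 1) else 2 * (k + 1))"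
        have y': "y' = r + k + 4"
          using 1 True Y_odd[of "k + 1"] by (simp add: e_def)
        have "Y h = y' \<longleftrightarrow> h = e \<or> h = g" if "h \<in> ?J" for h
          using that True k(2) unfolding y' Y_def e_def g_def lessThan_iff by (auto; presburger)
        moreover have "2 * r + 3 \<le> g" "g \<in> ?J" "g \<noteq> e" "g \<noteq> f" "2 * r + 3 \<le> f"
          using True k(2) p by (auto simp: g_def e_def f_def)
        ultimately have "\<not> unmatched ?J X Y x'"
          using 1(2) Zinj by (intro balanced_exchange[OF H x(1) y z, of e f g])
            (auto simp: X k e_def f_def)
        with XYx' show False by simp
      next
        case 2
        \<comment> \<open>The neighbour of \<open>f\<close> through \<open>Y\<close>, wrapping
          around when \<open>f\<close> is the last edge.\<close>
        define g where "g = (if k + 1 = r + p then 2 * r + 3 else 2 * (k + 2) + 1)"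
        have y': "y' = (if k + 1 = r + p then 2 * r + 4 else r + k + 5)"
          using 2 True Y_even[of "k + 2"] by (simp add: f_def)
        have "Y h = y' \<longleftrightarrow> h = f \<or> h = g" if "h \<in> ?J" for h
          using that True k(2) unfolding y' Y_def f_def g_def lessThan_iff by (auto; presburger)
        moreover have "2 * r + 3 \<le> g" "g \<in> ?J" "g \<noteq> e" "g \<noteq> f" "2 * r + 3 \<le> e"
          using True k(2) p by (auto simp: g_def e_def f_def)
        ultimately have "\<not> unmatched ?J X Y x'"
          using 2(1) Zinj by (intro balanced_exchange[OF H x(1) y z, of f e g])
            (auto simp: X k e_def f_def)
        with XYx' show False by simp
      qed
    next
      case False
      have Yinj: "Y h = Y g \<longleftrightarrow> h = g" if "2 \<le> g" "g \<le> 2 * r + 2" "h \<in> ?J" for h g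
        using that by (auto simp: Y_def)
      from cases show False
      proof cases
        case 1
        show False
        proof (cases "k + 1 = r")
          \<comment> \<open>Here \<open>f\<close> is edge \<open>2 * r + 2\<close>, whose neighbour
            through \<open>Z\<close> is edge 0. That edge shares its value of \<open>Y\<close> with
            edge 1, so \<open>balanced_exchange\<close> does not apply. Edges 0, 1, 2 force
            \<open>y\<close>, \<open>x'\<close>, \<open>z\<close> in turn, and edge 3 gives the
            contradiction.\<close>
          case True
          then have v: "y' = 2 * r + 2" "z' = 2" "x = r + 2" "1 \<le> r"
            using 1 k by (auto simp: Y_def Z_def e_def f_def)
          have vals: "X 0 = 1" "X 1 = 2" "X 2 = 2" "X 3 = 3" "Y 2 = 3" "Y 3 = 4" "Z 2 = 3" "Z 3 = 3"
            using True by (auto simp: X_def Y_def Z_def)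
          have "y = 2"
            using balancedD[OF H, of 0] v vals(1) z Y_small(1) Z_small(1)
            by (cases "y = 2") auto
          moreover from this have "x' = 2"
            using balancedD[OF H, of 1] v vals(2) Y_small(2) Z_small(2)
            by (cases "x' = 2") auto
          moreover have "3 \<noteq> 2 * r + 2"
            by presburger
          ultimately have "z = 3"
            using balancedD[OF H, of 2] v vals(3,5,7) by (cases "z = 3") auto
          then show False
            using balancedD[OF H, of 3] v vals(4,6,8) \<open>x' = 2\<close> \<open>y = 2\<close>
            by (cases "r = 1") auto
        next
          case neq_r: False
          define g where "g = 2 * (k + 2) + 1"
          have "Z h = z' \<longleftrightarrow> h = f \<or> h = g" if "h \<in> ?J" for h
          proof -
            have z': "z' = k + 4"
              using 1 False neq_r Z_even[of "k + 2"] by (simp add: f_def)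
            show ?thesis
              using that False neq_r unfolding z' Z_def f_def g_def by (auto; presburger)
          qed
          moreover have "2 \<le> g" "g \<le> 2 * r + 2" "g \<in> ?J" "g \<noteq> e" "g \<noteq> f" "2 \<le> e" "e \<le> 2 * r + 2"
            using False neq_r by (auto simp: g_def e_def f_def)
          ultimately have "\<not> unmatched ?J X Z x'"
            using 1(1) Yinj by (intro balanced_exchange[OF H' x(1) z y, of f e g])
              (auto simp: X k e_def f_def)
          with XZx' show False by simp
        qed
      next
        case 2
        define g where "g = 2 * (k + 1)"
        have "Z h = z' \<longleftrightarrow> h = e \<or> h = g" if "h \<in> ?J" for h
        proof -
          have z': "z' = k + 3"
            using 2 False Z_odd[of "k + 1"] by (simp add: e_def)
          show ?thesis
            using that False unfolding z' Z_def e_def g_def by (auto; presburger)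
        qed
        moreover have "2 \<le> g" "g \<le> 2 * r + 2" "g \<in> ?J" "g \<noteq> e" "g \<noteq> f" "2 \<le> f" "f \<le> 2 * r + 2"
          using False by (auto simp: g_def e_def f_def)
        ultimately have "\<not> unmatched ?J X Z x'"
          using 2(2) Yinj by (intro balanced_exchange[OF H' x(1) z y, of e f g])
            (auto simp: X k e_def f_def)
        with XZx' show False by simp
      qed
    qed
  qed
  \<comment> \<open>Edges 0 and 1 exclude \<open>y = 2\<close> and force \<open>z = 2\<close> and
    \<open>z' = r + 3\<close>. Edges 2 and \<open>2 * r + 2\<close>, which coincide for
    \<open>r = 0\<close>, then cannot both be balanced.\<close>
  have eq_2: False
    if H: "balanced ?J X Y Z (2, y, z) (1, y', z')" for y z y' z'
  proof -
    have "y \<noteq> y'" "z \<noteq> z'"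
      using balanced_middle_distinct[OF H XZ] balanced_last_distinct[OF H XY] by auto
    moreover have "X 0 = 1" "X 1 = 2" "X 2 = 2" "X (2 * r + 2) = r + 2" "Y 2 = 3"
      "Z 2 = (if r = 0 then 2 else 3)"
      by (auto simp: X_def Y_def Z_def)
    ultimately show False
      using balancedD[OF H, of 0] balancedD[OF H, of 1] balancedD[OF H, of 2]
        balancedD[OF H, of "2 * r + 2"] Y_small Z_small
      by (auto simp: of_bool_def split: if_splits)
  qed
  show "\<And>e. e < ?n \<Longrightarrow> X e \<in> {1..?a} \<and> Y e \<in> {1..?b} \<and> Z e \<in> {1..?c}"
    by (auto simp: X_def Y_def Z_def)
  show "resolves ?J X Y Z ?a ?b ?c"
  proof (rule resolvesI)
    fix x y z x' y' z'
    assume H: "balanced ?J X Y Z (x, y, z) (x', y', z')" and r: "x \<in> {1..?a}" "x' \<in> {1..?a}"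
    note H' = balanced_sym[OF H]
    show "x = x'"
    proof (rule ccontr)
      assume "x \<noteq> x'"
      with ge_3[OF H] ge_3[OF H'] r have "\<not> 3 \<le> x" "\<not> 3 \<le> x'" by auto
      with r \<open>x \<noteq> x'\<close> have "x = 2 \<and> x' = 1 \<or> x = 1 \<and> x' = 2"
        unfolding atLeastAtMost_iff by linarith
      with eq_2 H H' show False by blast
    qed
  next
    fix y y' assume r: "y \<in> {1..?b}" "y' \<in> {1..?b}" "y \<noteq> y'"
    then have "2 \<le> y \<or> 2 \<le> y'"
      unfolding atLeastAtMost_iff by linarith
    then show "unmatched ?J Y Z y \<or> unmatched ?J Y Z y'"
      using YZ r by auto
  next
    fix z z' assume r: "z \<in> {1..?c}" "z' \<in> {1..?c}" "z \<noteq> z'"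
    then have "2 \<le> z \<or> 2 \<le> z'"
      unfolding atLeastAtMost_iff by linarith
    then show "z \<in> Z ` ?J \<or> z' \<in> Z ` ?J"
      using Z_surj r by auto
  qed
qed

text \<open>Exchanging \<open>p\<close> and \<open>r\<close> swaps the second and third sizes, which
  handles \<open>p = 1\<close>.\<close>

lemma complete_product_dim_le_triangle_cycle:
  assumes "p \<noteq> 1 \<or> r \<noteq> 1"
  shows "complete_product_dim (p + r + 2) (p + 2 * r + 3) (2 * p + r + 3) \<le> 2 * r + 2 * p + 3"
proof (cases "p = 1")
  case False
  show ?thesis
    by (rule complete_product_dim_le[OF triangle_cycle_resolves[OF False]])
next
  case True
  with assms have "r \<noteq> 1" by simp
  note tri = triangle_cycle_resolves[where p = r and r = p, OF this]
  have "complete_product_dim (r + p + 2) (2 * r + p + 3) (r + 2 * p + 3) \<le> 2 * p + 2 * r + 3"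
    by (rule complete_product_dim_le[OF resolves_swap[OF tri(1)]]) (use tri(2) in blast)
  then show ?thesis
    by (simp add: add_ac)
qed

theorem theorem5:
  fixes a b c :: nat
  assumes "1 \<le> a" and "1 \<le> b" and "1 \<le> c"
    and "a \<le> b" and "b \<le> c"
    and "3 * a = b + c"
    and "(a, b, c) \<noteq> (4, 6, 6)"
  shows "int (complete_product_dim a b c) = \<lfloor>real (a + b + c) / 2\<rfloor> - 1"
proof -
  \<comment> \<open>The counting bound reads \<open>4 a \<le> 2 q + 3\<close>, and parity improves
    it to \<open>4 a \<le> 2 q + 2\<close>.\<close>
  have "2 * a \<le> complete_product_dim a b c + 1"
    using complete_product_dim_ge[OF assms(1-3)] assms(6) by linarith
  moreover have "complete_product_dim a b c + 1 \<le> 2 * a"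
  proof (cases "b = a")
    case True
    then have "c = 2 * a"
      using assms(6) by simp
    then have "complete_product_dim a b c \<le> 2 * a - 1"
      using complete_product_dim_le[OF path_resolves[OF assms(1)]] True by simp
    then show ?thesis
      using assms(1) by simp
  next
    case False
    \<comment> \<open>With these parameters \<open>3 * a = b + c\<close> becomes
      \<open>a = p + r + 2\<close>, and \<open>p = r = 1\<close> is exactly
      \<open>(4, 6, 6)\<close>.\<close>
    define r where "r = b - a - 1"
    define p where "p = c - a - 1"
    have rp: "b = a + r + 1" "c = a + p + 1"
      using False assms(4,5) by (auto simp: r_def p_def)
    then have abc: "a = p + r + 2" "b = p + 2 * r + 3" "c = 2 * p + r + 3"
      using assms(6) by auto
    have "p \<noteq> 1 \<or> r \<noteq> 1"
      using assms(7) abc by auto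
    from complete_product_dim_le_triangle_cycle[OF this] show ?thesis
      unfolding abc by simp
  qed
  ultimately have "complete_product_dim a b c + 1 = 2 * a"
    by (rule le_antisym[rotated])
  then have "int (complete_product_dim a b c) = 2 * int a - 1"
    by linarith
  moreover have "real (a + b + c) / 2 = of_int (2 * int a)"
    using assms(6) by (simp flip: of_nat_add)
  ultimately show ?thesis
    by (simp only: floor_of_int)
qed

end
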